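(* Let $(M,\Delta,S,\varepsilon)$ be a weak Kac algebra. Then $(M,\Delta,S)$ is a generalized counital $C^*$-bialgebra, i.e. the map $\varepsilon_t=\mu(\mathrm{id}\otimes S)\Delta$ satisfies: (1) $\varepsilon_t(1)=1$; (2) $\varepsilon_t(M)\subset N_t$; (3) $(\mathrm{id}\otimes\varepsilon_t)\Delta(x)=e(x\otimes 1)$ for all $x\in N_s$.
   Context: All algebras are finite-dimensional over $\mathbb{C}$; $\varsigma$ denotes the flip $x\otimes y\mapsto y\otimes x$ and $\mu(x\otimes y)=xy$. A weak Kac algebra is a quadruple $(M,\Delta,S,\varepsilon)$ where $M$ is a finite-dimensional $C^*$-algebra; $\Delta:M\to M\otimes M$ is an injective, not necessarily unital, $*$-homomorphism with $(\Delta\otimes\mathrm{id})\Delta=(\mathrm{id}\otimes\Delta)\Delta$; $S:M\to M$ is a linear, unital, antimultiplicative, $*$-preserving bijection with $S^2=\mathrm{id}$ and $(S\otimes S)\circ\Delta=\varsigma\circ\Delta\circ S$; and $\varepsilon:M\to\mathbb{C}$ is linear with $(\varepsilon\otimes\mathrm{id})\Delta=(\mathrm{id}\otimes\varepsilon)\Delta=\mathrm{id}$, $\varepsilon\circ S=\varepsilon$, $\varepsilon(x^* )=\overline{\varepsilon(x)}$, $(\varepsilon\otimes\varepsilon)((x\otimes1)e(1\otimes y))=\varepsilon(xy)$ for all $x,y$, where $e:=\Delta(1)$, and $(\varepsilon_s\otimes\mathrm{id})\Delta(x)=(1\otimes x)e$ for all $x$, where $\varepsilon_s:=\mu(S\otimes\mathrm{id})\Delta$.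 The target and source Cartan subalgebras are $N_t=\{x\in M:\Delta(x)=e(x\otimes 1)=(x\otimes1)e\}$ and $N_s=\{x\in M:\Delta(x)=e(1\otimes x)=(1\otimes x)e\}$. *)

theory Defs
  imports "HOL-Analysis.Analysis"
begin

text \<open>Finite-dimensional C*-algebras are realised concretely as unital *-subalgebras
of the full matrix algebra of complex 'n x 'n matrices ('n a finite index type);
the algebraic tensor product M (x) M is realised inside the matrices indexed by 'n x 'n
via Kronecker products.\<close>

type_synonym 'n cmat = "complex^'n^'n"

definition csmul :: "complex \<Rightarrow> complex^'n^'m \<Rightarrow> complex^'n^'m" where
  "csmul c A = (\<chi> i j. c * A$i$j)"

definition adjm :: "complex^('n::finite)^'n \<Rightarrow> complex^'n^'n" where
  "adjm A = (\<chi> i j. cnj (A$j$i))"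

text \<open>Kronecker (tensor) product of matrices.\<close>
definition tens :: "complex^('a::finite)^'a \<Rightarrow> complex^('b::finite)^'b \<Rightarrow> complex^('a\<times>'b)^('a\<times>'b)" where
  "tens A B = (\<chi> p q. A$(fst p)$(fst q) * B$(snd p)$(snd q))"

text \<open>M is a finite-dimensional C*-algebra: a unital *-subalgebra of the matrices.\<close>
definition cstar_subalg :: "('n::finite) cmat set \<Rightarrow> bool" where
  "cstar_subalg M \<longleftrightarrow> mat 1 \<in> M \<and> 0 \<in> M
     \<and> (\<forall>x\<in>M. \<forall>y\<in>M. x + y \<in> M \<and> x ** y \<in> M)
     \<and> (\<forall>c. \<forall>x\<in>M. csmul c x \<in> M) \<and> (\<forall>x\<in>M. adjm x \<in> M)"

text \<open>The algebraic tensor product M (x) M.\<close>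
definition tsp :: "('n::finite) cmat set \<Rightarrow> ('n\<times>'n) cmat set" where
  "tsp M = {(\<Sum>k<m. tens (a k) (b k)) | (m::nat) a b. \<forall>k<m. a k \<in> M \<and> b k \<in> M}"

text \<open>Application of the linear map (f (x) g) followed by the bilinear "combination" c
to an element of M (x) M: for X = sum_k a_k (x) b_k it is sum_k c (f a_k) (g b_k).
(Well defined whenever f, g are linear on M and c is bilinear.)\<close>
definition tmap :: "('n::finite) cmat set \<Rightarrow> ('x \<Rightarrow> 'y \<Rightarrow> 'z::comm_monoid_add)
     \<Rightarrow> ('n cmat \<Rightarrow> 'x) \<Rightarrow> ('n cmat \<Rightarrow> 'y) \<Rightarrow> ('n\<times>'n) cmat \<Rightarrow> 'z" where
  "tmap M c f g X = (THE Y. \<exists>(m::nat) a b. (\<forall>k<m. a k \<in> M \<and> b k \<in> M)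
      \<and> X = (\<Sum>k<m. tens (a k) (b k)) \<and> Y = (\<Sum>k<m. c (f (a k)) (g (b k))))"

text \<open>The flip x (x) y \<mapsto> y (x) x.\<close>
definition flip :: "(('n::finite)\<times>'n) cmat \<Rightarrow> ('n\<times>'n) cmat" where
  "flip X = (\<chi> p q. X$(snd p, fst p)$(snd q, fst q))"

text \<open>Reassociation (M(x)M)(x)M \<rightarrow> M(x)(M(x)M).\<close>
definition reassoc :: "((('n::finite)\<times>'n)\<times>'n) cmat \<Rightarrow> ('n\<times>('n\<times>'n)) cmat" where
  "reassoc X = (\<chi> p q. X$((fst p, fst (snd p)), snd (snd p))$((fst q, fst (snd q)), snd (snd q)))"

definition Nt :: "('n::finite) cmat set \<Rightarrow> ('n cmat \<Rightarrow> ('n\<times>'n) cmat) \<Rightarrow> 'n cmat set" where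
  "Nt M \<Delta> = {x\<in>M. \<Delta> x = \<Delta> (mat 1) ** tens x (mat 1) \<and> \<Delta> x = tens x (mat 1) ** \<Delta> (mat 1)}"

definition Ns :: "('n::finite) cmat set \<Rightarrow> ('n cmat \<Rightarrow> ('n\<times>'n) cmat) \<Rightarrow> 'n cmat set" where
  "Ns M \<Delta> = {x\<in>M. \<Delta> x = \<Delta> (mat 1) ** tens (mat 1) x \<and> \<Delta> x = tens (mat 1) x ** \<Delta> (mat 1)}"

text \<open>epsilon_s = mu (S (x) id) Delta and epsilon_t = mu (id (x) S) Delta.\<close>
definition eps_s :: "('n::finite) cmat set \<Rightarrow> ('n cmat \<Rightarrow> ('n\<times>'n) cmat) \<Rightarrow> ('n cmat \<Rightarrow> 'n cmat) \<Rightarrow> 'n cmat \<Rightarrow> 'n cmat" where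
  "eps_s M \<Delta> S x = tmap M (**) S id (\<Delta> x)"

definition eps_t :: "('n::finite) cmat set \<Rightarrow> ('n cmat \<Rightarrow> ('n\<times>'n) cmat) \<Rightarrow> ('n cmat \<Rightarrow> 'n cmat) \<Rightarrow> 'n cmat \<Rightarrow> 'n cmat" where
  "eps_t M \<Delta> S x = tmap M (**) id S (\<Delta> x)"

definition weak_kac :: "('n::finite) cmat set \<Rightarrow> ('n cmat \<Rightarrow> ('n\<times>'n) cmat) \<Rightarrow> ('n cmat \<Rightarrow> 'n cmat)
    \<Rightarrow> ('n cmat \<Rightarrow> complex) \<Rightarrow> bool" where
  "weak_kac M \<Delta> S \<epsilon> \<longleftrightarrow>
     cstar_subalg M
     \<comment> \<open>Delta: injective, not necessarily unital *-homomorphism M -> M (x) M, coassociative\<close>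
     \<and> (\<forall>x\<in>M. \<Delta> x \<in> tsp M) \<and> inj_on \<Delta> M
     \<and> (\<forall>x\<in>M. \<forall>y\<in>M. \<Delta> (x + y) = \<Delta> x + \<Delta> y \<and> \<Delta> (x ** y) = \<Delta> x ** \<Delta> y)
     \<and> (\<forall>c. \<forall>x\<in>M. \<Delta> (csmul c x) = csmul c (\<Delta> x))
     \<and> (\<forall>x\<in>M. \<Delta> (adjm x) = adjm (\<Delta> x))
     \<and> (\<forall>x\<in>M. reassoc (tmap M tens \<Delta> id (\<Delta> x)) = tmap M tens id \<Delta> (\<Delta> x))
     \<comment> \<open>S: linear, unital, antimultiplicative, *-preserving involutive bijection\<close>
     \<and> bij_betw S M M
     \<and> (\<forall>x\<in>M. \<forall>y\<in>M. S (x + y) = S x + S y \<and> S (x ** y) = S y ** S x)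
     \<and> (\<forall>c. \<forall>x\<in>M. S (csmul c x) = csmul c (S x))
     \<and> S (mat 1) = mat 1
     \<and> (\<forall>x\<in>M. S (adjm x) = adjm (S x))
     \<and> (\<forall>x\<in>M. S (S x) = x)
     \<and> (\<forall>x\<in>M. tmap M tens S S (\<Delta> x) = flip (\<Delta> (S x)))
     \<comment> \<open>epsilon: linear counit\<close>
     \<and> (\<forall>x\<in>M. \<forall>y\<in>M. \<epsilon> (x + y) = \<epsilon> x + \<epsilon> y)
     \<and> (\<forall>c. \<forall>x\<in>M. \<epsilon> (csmul c x) = c * \<epsilon> x)
     \<and> (\<forall>x\<in>M. tmap M csmul \<epsilon> id (\<Delta> x) = x)
     \<and> (\<forall>x\<in>M. tmap M (\<lambda>y c. csmul c y) id \<epsilon> (\<Delta> x) = x)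
     \<and> (\<forall>x\<in>M. \<epsilon> (S x) = \<epsilon> x)
     \<and> (\<forall>x\<in>M. \<epsilon> (adjm x) = cnj (\<epsilon> x))
     \<and> (\<forall>x\<in>M. \<forall>y\<in>M. tmap M (*) \<epsilon> \<epsilon> (tens x (mat 1) ** \<Delta> (mat 1) ** tens (mat 1) y)
            = \<epsilon> (x ** y))
     \<and> (\<forall>x\<in>M. tmap M tens (eps_s M \<Delta> S) id (\<Delta> x) = tens (mat 1) x ** \<Delta> (mat 1))"

end

theory Submission
  imports Defs
begin

text \<open>
  Elements of \<open>M \<otimes> M\<close> are sums of Kronecker products, and \<open>tmap\<close> applies a map
  \<open>f \<otimes> g\<close> through any such representation; this is well defined because a balanced bilinear
  map annihilates every vanishing sum of elementary tensors.

  Applying \<open>\<varsigma> \<circ> (S \<otimes> S)\<close> to the axiom \<open>(\<epsilon>\<^sub>s \<otimes> id) \<Delta>(x) = (1 \<otimes> x) e\<close> and using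
  \<open>S \<epsilon>\<^sub>s S = \<epsilon>\<^sub>t\<close> gives \<open>(id \<otimes> \<epsilon>\<^sub>t) \<Delta>(x) = e (x \<otimes> 1)\<close> for every \<open>x \<in> M\<close>, which is (3).
  Applying \<open>\<epsilon> \<otimes> id\<close> to this identity gives \<open>\<epsilon>\<^sub>t(y) = (\<epsilon>(\<cdot> y) \<otimes> id)(e)\<close>; in particular
  \<open>\<epsilon>\<^sub>t(1) = 1\<close>. As \<open>\<Delta>\<close> and \<open>z \<mapsto> e (z \<otimes> 1)\<close> are linear, for (2) it suffices to show
  \<open>\<Delta>(z) = e (z \<otimes> 1)\<close> for the slices \<open>z = (\<omega>\<^sub>s\<^sub>t \<otimes> id)(e)\<close> of \<open>e\<close> by the matrix-unit
  functionals. Coassociativity writes \<open>\<Delta>(z)\<close> as \<open>(L \<otimes> id)(e)\<close> for a linear \<open>L\<close>; this tensor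
  is fixed by \<open>id \<otimes> \<epsilon>\<^sub>t\<close> because \<open>e\<close> is, so \<open>\<Delta>(z) = e (z \<otimes> 1)\<close>. The identity
  \<open>\<Delta>(z) = (z \<otimes> 1) e\<close> follows by taking adjoints, as \<open>e\<^sup>* = e\<close>.
\<close>

section \<open>Matrix identities\<close>

lemma cmat_eqI: "(\<And>i j. A $ i $ j = B $ i $ j) \<Longrightarrow> A = B"
  by (simp add: vec_eq_iff)

lemma csmul_nth [simp]: "csmul c A $ i $ j = c * A $ i $ j"
  by (simp add: csmul_def)

lemma adjm_nth [simp]: "adjm A $ i $ j = cnj (A $ j $ i)"
  by (simp add: adjm_def)

lemma tens_nth [simp]: "tens A B $ p $ q = A $ fst p $ fst q * B $ snd p $ snd q"
  by (simp add: tens_def)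

lemma csmul_add: "csmul c (A + B) = csmul c A + csmul c B"
  by (rule cmat_eqI) (simp add: algebra_simps)

lemma csmul_add_left: "csmul (c + d) A = csmul c A + csmul d A"
  by (rule cmat_eqI) (simp add: algebra_simps)

lemma csmul_csmul: "csmul c (csmul d A) = csmul (c * d) A"
  by (rule cmat_eqI) simp

lemma csmul_zero [simp]: "csmul c 0 = 0"
  by (rule cmat_eqI) simp

lemma csmul_zero_left [simp]: "csmul 0 A = 0"
  by (rule cmat_eqI) simp

lemma csmul_minus_one: "csmul (- 1) A = - A"
  by (rule cmat_eqI) simp

lemma csmul_sum: "csmul c (\<Sum>i\<in>I. A i) = (\<Sum>i\<in>I. csmul c (A i))"
  by (rule cmat_eqI) (simp add: sum_distrib_left)

lemma matrix_add_rdistrib: "((A::complex^_^_) + B) ** C = A ** C + B ** C"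
  by (rule cmat_eqI) (simp add: matrix_matrix_mult_def distrib_right sum.distrib)

lemma matrix_csmul_left: "csmul c A ** B = csmul c (A ** B)"
  by (rule cmat_eqI) (simp add: matrix_matrix_mult_def sum_distrib_left algebra_simps)

lemma matrix_csmul_right: "A ** csmul c B = csmul c (A ** B)"
  by (rule cmat_eqI) (simp add: matrix_matrix_mult_def sum_distrib_left algebra_simps)

lemma matrix_sum_left: "(\<Sum>i\<in>I. A i) ** (B::complex^_^_) = (\<Sum>i\<in>I. A i ** B)"
  by (rule cmat_eqI) (simp add: matrix_matrix_mult_def sum_distrib_right sum.swap[of _ I])

lemma matrix_sum_right: "(B::complex^_^_) ** (\<Sum>i\<in>I. A i) = (\<Sum>i\<in>I. B ** A i)"
  by (rule cmat_eqI) (simp add: matrix_matrix_mult_def sum_distrib_left sum.swap[of _ I])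

lemma tens_add_left: "tens (A + A') B = tens A B + tens A' B"
  by (rule cmat_eqI) (simp add: algebra_simps)

lemma tens_add_right: "tens A (B + B') = tens A B + tens A B'"
  by (rule cmat_eqI) (simp add: algebra_simps)

lemma tens_csmul_left: "tens (csmul c A) B = csmul c (tens A B)"
  by (rule cmat_eqI) (simp add: algebra_simps)

lemma tens_csmul_right: "tens A (csmul c B) = csmul c (tens A B)"
  by (rule cmat_eqI) (simp add: algebra_simps)

lemma tens_uminus_left: "tens (- A) B = - tens A B"
  by (rule cmat_eqI) simp

lemma tens_sum_left: "tens (\<Sum>i\<in>I. A i) B = (\<Sum>i\<in>I. tens (A i) B)"
  by (rule cmat_eqI) (simp add: sum_distrib_right)

lemma tens_one: "tens (mat 1) (mat 1) = mat 1"
  by (rule cmat_eqI) (auto simp: mat_def prod_eq_iff)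

lemma sum_UNIV_prod: "(\<Sum>r\<in>UNIV. f r) = (\<Sum>k\<in>UNIV. \<Sum>l\<in>UNIV. f (k, l))"
  by (simp add: sum.cartesian_product flip: UNIV_Times_UNIV)

lemma tens_mult: "tens A B ** tens C D = tens (A ** C) (B ** (D::complex^_^_))"
  by (rule cmat_eqI)
    (simp only: matrix_matrix_mult_def tens_nth vec_lambda_beta sum_UNIV_prod sum_product
      fst_conv snd_conv mult.assoc mult.left_commute)

lemma adjm_tens: "adjm (tens A B) = tens (adjm A) (adjm B)"
  by (rule cmat_eqI) simp

lemma adjm_mult: "adjm (A ** B) = adjm B ** adjm A"
  by (rule cmat_eqI) (simp add: matrix_matrix_mult_def mult.commute)

lemma adjm_one: "adjm (mat 1) = mat 1"
  by (rule cmat_eqI) (simp add: mat_def)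

lemma flip_tens: "flip (tens A B) = tens B A"
  by (rule cmat_eqI) (simp add: flip_def)

lemma flip_flip: "flip (flip X) = X"
  by (rule cmat_eqI) (simp add: flip_def)

lemma flip_sum: "flip (\<Sum>i\<in>I. A i) = (\<Sum>i\<in>I. flip (A i))"
  by (rule cmat_eqI) (simp add: flip_def)

lemma reassoc_sum: "reassoc (\<Sum>i\<in>I. A i) = (\<Sum>i\<in>I. reassoc (A i))"
  by (rule cmat_eqI) (simp add: reassoc_def)

lemma sum_tens_eq_0_imp_lincomb:
  assumes fin: "finite I" and kI: "k \<in> I" and vanish: "(\<Sum>i\<in>I. tens (a i) (b i)) = 0"
    and bk: "b k $ s $ t \<noteq> 0"
  shows "a k = (\<Sum>i\<in>I - {k}. csmul (- b i $ s $ t / b k $ s $ t) (a i))"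
proof (rule cmat_eqI)
  fix x y
  have "(\<Sum>i\<in>I. a i $ x $ y * b i $ s $ t) = 0"
    using arg_cong[OF vanish, of "\<lambda>X. X $ (x, s) $ (y, t)"] by simp
  then have "a k $ x $ y * b k $ s $ t = - (\<Sum>i\<in>I - {k}. a i $ x $ y * b i $ s $ t)"
    by (simp add: sum.remove[OF fin kI] eq_neg_iff_add_eq_0)
  then have "a k $ x $ y = - (\<Sum>i\<in>I - {k}. a i $ x $ y * b i $ s $ t) / b k $ s $ t"
    using bk by (simp add: field_simps)
  then show "a k $ x $ y = (\<Sum>i\<in>I - {k}. csmul (- b i $ s $ t / b k $ s $ t) (a i)) $ x $ y"
    by (simp add: sum_divide_distrib sum_negf ac_simps)
qed

section \<open>Slices\<close>

text \<open>The slice map \<open>\<omega>\<^sub>s\<^sub>t \<otimes> id\<close> of the matrix-unit functional \<open>\<omega>\<^sub>s\<^sub>t(a) = a$s$t\<close>.\<close>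

definition slice :: "'a \<Rightarrow> 'a \<Rightarrow> complex^('a::finite\<times>'b::finite)^('a\<times>'b) \<Rightarrow> complex^'b^'b" where
  "slice s t X = (\<chi> i j. X $ (s, i) $ (t, j))"

lemma slice_nth [simp]: "slice s t X $ i $ j = X $ (s, i) $ (t, j)"
  by (simp add: slice_def)

lemma slice_tens [simp]: "slice s t (tens A B) = csmul (A $ s $ t) B"
  by (rule cmat_eqI) simp

lemma slice_add: "slice s t (X + Y) = slice s t X + slice s t Y"
  by (rule cmat_eqI) simp

lemma slice_csmul: "slice s t (csmul c X) = csmul c (slice s t X)"
  by (rule cmat_eqI) simp

lemma slice_sum: "slice s t (\<Sum>i\<in>I. X i) = (\<Sum>i\<in>I. slice s t (X i))"
  by (rule cmat_eqI) simp

lemma slice_adjm: "slice s t (adjm X) = adjm (slice t s X)"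
  by (rule cmat_eqI) simp

lemma slice_reassoc_tens: "slice s t (reassoc (tens X B)) = tens (slice s t X) B"
  by (rule cmat_eqI) (simp add: reassoc_def)

lemma cmat_eq_if_slices_eq: "(\<And>s t. slice s t X = slice s t Y) \<Longrightarrow> X = Y"
  by (rule cmat_eqI) (metis prod.collapse slice_nth)

section \<open>Balanced bilinear maps and the algebraic tensor product\<close>

definition csubspace :: "('a::finite) cmat set \<Rightarrow> bool" where
  "csubspace V \<longleftrightarrow> 0 \<in> V \<and> (\<forall>x\<in>V. \<forall>y\<in>V. x + y \<in> V) \<and> (\<forall>c. \<forall>x\<in>V. csmul c x \<in> V)"

lemma csubspace_UNIV: "csubspace UNIV"
  by (simp add: csubspace_def)

context
  fixes V assumes V: "csubspace V"
begin

lemma csubspace_zero: "0 \<in> V"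
  using V by (simp add: csubspace_def)

lemma csubspace_add: "x \<in> V \<Longrightarrow> y \<in> V \<Longrightarrow> x + y \<in> V"
  using V by (simp add: csubspace_def)

lemma csubspace_csmul: "x \<in> V \<Longrightarrow> csmul c x \<in> V"
  using V by (simp add: csubspace_def)

lemma csubspace_uminus: "x \<in> V \<Longrightarrow> - x \<in> V"
  by (metis csmul_minus_one csubspace_csmul)

lemma csubspace_sum: "finite I \<Longrightarrow> (\<And>i. i \<in> I \<Longrightarrow> x i \<in> V) \<Longrightarrow> (\<Sum>i\<in>I. x i) \<in> V"
  by (induction I rule: finite_induct) (auto intro: csubspace_zero csubspace_add)

end

definition linear_on ::
    "('a::finite) cmat set \<Rightarrow> ('a cmat \<Rightarrow> complex^('p::finite)^('q::finite)) \<Rightarrow> bool" where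
  "linear_on V f \<longleftrightarrow>
     (\<forall>x\<in>V. \<forall>y\<in>V. f (x + y) = f x + f y) \<and> (\<forall>c. \<forall>x\<in>V. f (csmul c x) = csmul c (f x))"

definition linear_form_on :: "('a::finite) cmat set \<Rightarrow> ('a cmat \<Rightarrow> complex) \<Rightarrow> bool" where
  "linear_form_on V f \<longleftrightarrow>
     (\<forall>x\<in>V. \<forall>y\<in>V. f (x + y) = f x + f y) \<and> (\<forall>c. \<forall>x\<in>V. f (csmul c x) = c * f x)"

lemma linear_onD:
  "linear_on V f \<Longrightarrow> x \<in> V \<Longrightarrow> y \<in> V \<Longrightarrow> f (x + y) = f x + f y"
  "linear_on V f \<Longrightarrow> x \<in> V \<Longrightarrow> f (csmul c x) = csmul c (f x)"
  by (auto simp: linear_on_def)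

lemma linear_on_id: "linear_on V id"
  by (simp add: linear_on_def)

lemma linear_on_comp:
  "linear_on V f \<Longrightarrow> (\<And>x. x \<in> V \<Longrightarrow> f x \<in> W) \<Longrightarrow> linear_on W g \<Longrightarrow> linear_on V (\<lambda>x. g (f x))"
  by (simp add: linear_on_def)

lemma linear_on_sum:
  assumes f: "linear_on V f" and V: "csubspace V" and "finite I" "\<And>i. i \<in> I \<Longrightarrow> x i \<in> V"
  shows "f (\<Sum>i\<in>I. x i) = (\<Sum>i\<in>I. f (x i))"
  using assms(3,4)
proof (induction I rule: finite_induct)
  case empty
  have "f 0 = csmul 0 (f 0)"
    using linear_onD(2)[OF f csubspace_zero[OF V], of 0] by simp
  then show ?case by simp
next
  case (insert j I)
  then show ?case
    by (simp add: linear_onD(1)[OF f] csubspace_sum[OF V])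
qed

lemma linear_on_lincomb:
  assumes "linear_on V f" "csubspace V" "finite I" "\<And>i. i \<in> I \<Longrightarrow> x i \<in> V"
  shows "f (\<Sum>i\<in>I. csmul (c i) (x i)) = (\<Sum>i\<in>I. csmul (c i) (f (x i)))"
  using assms by (simp add: linear_on_sum linear_onD(2) csubspace_csmul)

text \<open>These are exactly the maps that factor through the algebraic tensor product.\<close>

locale bilinear_on =
  fixes M :: "('a::finite) cmat set" and N :: "('b::finite) cmat set"
    and B :: "'a cmat \<Rightarrow> 'b cmat \<Rightarrow> 'z::ab_group_add"
  assumes csubspace_left: "csubspace M" and csubspace_right: "csubspace N"
    and add_left: "\<And>x x' y. x \<in> M \<Longrightarrow> x' \<in> M \<Longrightarrow> y \<in> N \<Longrightarrow> B (x + x') y = B x y + B x' y"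
    and add_right: "\<And>x y y'. x \<in> M \<Longrightarrow> y \<in> N \<Longrightarrow> y' \<in> N \<Longrightarrow> B x (y + y') = B x y + B x y'"
    and balanced: "\<And>c x y. x \<in> M \<Longrightarrow> y \<in> N \<Longrightarrow> B (csmul c x) y = B x (csmul c y)"
begin

lemma zero_left: "y \<in> N \<Longrightarrow> B 0 y = 0"
  using add_left[of 0 0 y] csubspace_zero[OF csubspace_left] by simp

lemma zero_right: "x \<in> M \<Longrightarrow> B x 0 = 0"
  using add_right[of x 0 0] csubspace_zero[OF csubspace_right] by simp

lemma uminus_left: "x \<in> M \<Longrightarrow> y \<in> N \<Longrightarrow> B (- x) y = - B x y"
  using add_left[of "- x" x y] zero_left[of y] csubspace_uminus[OF csubspace_left]
  by (simp add: eq_neg_iff_add_eq_0)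

lemma sum_left:
  "finite I \<Longrightarrow> (\<And>i. i \<in> I \<Longrightarrow> x i \<in> M) \<Longrightarrow> y \<in> N \<Longrightarrow> B (\<Sum>i\<in>I. x i) y = (\<Sum>i\<in>I. B (x i) y)"
  by (induction I rule: finite_induct)
    (simp_all add: zero_left add_left csubspace_sum[OF csubspace_left])

text \<open>Induction on the number of terms: if some \<open>b\<^sub>k\<close> has a nonzero entry, comparing
  that entry of the vanishing tensor expresses \<open>a\<^sub>k\<close> as a combination of the other \<open>a\<^sub>i\<close>,
  and substituting it leaves a vanishing sum with one term fewer.\<close>

lemma sum_eq_0_if_sum_tens_eq_0:
  "finite I \<Longrightarrow> (\<forall>i\<in>I. a i \<in> M \<and> b i \<in> N) \<Longrightarrow> (\<Sum>i\<in>I. tens (a i) (b i)) = 0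
   \<Longrightarrow> (\<Sum>i\<in>I. B (a i) (b i)) = 0"
proof (induction "card I" arbitrary: I b rule: less_induct)
  case less
  note fin = less.prems(1) and mem = less.prems(2) and vanish = less.prems(3)
  show ?case
  proof (cases "\<exists>k\<in>I. b k \<noteq> 0")
    case False
    then show ?thesis using zero_right mem by simp
  next
    case True
    then obtain k where kI: "k \<in> I" and "b k \<noteq> 0" by blast
    then obtain s t where bk: "b k $ s $ t \<noteq> 0" by (metis cmat_eqI zero_index)
    define \<mu> where "\<mu> i = - b i $ s $ t / b k $ s $ t" for i
    define I' where "I' = I - {k}"
    define b' where "b' i = b i + csmul (\<mu> i) (b k)" for i
    have sum_I: "(\<Sum>i\<in>I. f i) = f k + (\<Sum>i\<in>I'. f i)" for f :: "_ \<Rightarrow> 'w::comm_monoid_add"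
      using sum.remove[OF fin kI] by (simp add: I'_def)
    have mem': "\<forall>i\<in>I'. a i \<in> M \<and> b' i \<in> N"
      using mem kI by (auto simp: I'_def b'_def intro!: csubspace_add csubspace_csmul
          csubspace_right)
    have ak: "a k = (\<Sum>i\<in>I'. csmul (\<mu> i) (a i))"
      unfolding \<mu>_def I'_def by (rule sum_tens_eq_0_imp_lincomb[OF fin kI vanish bk])
    have "(\<Sum>i\<in>I'. tens (a i) (b' i))
        = (\<Sum>i\<in>I'. tens (a i) (b i)) + tens (\<Sum>i\<in>I'. csmul (\<mu> i) (a i)) (b k)"
      by (simp add: b'_def tens_add_right tens_csmul_right tens_csmul_left tens_sum_left
          sum.distrib)
    also have "\<dots> = (\<Sum>i\<in>I. tens (a i) (b i))"
      by (simp only: sum_I flip: ak) (simp add: add.commute)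
    finally have "(\<Sum>i\<in>I'. B (a i) (b' i)) = 0"
      using less.hyps[of I' b'] fin mem' card_Diff1_less[OF fin kI] vanish by (simp add: I'_def)
    moreover have "(\<Sum>i\<in>I'. B (a i) (b' i))
        = (\<Sum>i\<in>I'. B (a i) (b i)) + (\<Sum>i\<in>I'. B (csmul (\<mu> i) (a i)) (b k))"
      unfolding sum.distrib[symmetric]
      using mem kI csubspace_csmul[OF csubspace_right]
      by (intro sum.cong refl) (simp add: I'_def b'_def add_right balanced)
    moreover have "(\<Sum>i\<in>I'. B (csmul (\<mu> i) (a i)) (b k)) = B (a k) (b k)"
      unfolding ak using mem kI fin
      by (subst sum_left) (auto simp: I'_def intro: csubspace_csmul[OF csubspace_left])
    ultimately show ?thesis
      by (simp add: sum_I add.commute)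
  qed
qed

lemma sum_eq_if_sum_tens_eq:
  assumes "finite I" "\<forall>i\<in>I. a i \<in> M \<and> b i \<in> N" "finite J" "\<forall>j\<in>J. a' j \<in> M \<and> b' j \<in> N"
    and "(\<Sum>i\<in>I. tens (a i) (b i)) = (\<Sum>j\<in>J. tens (a' j) (b' j))"
  shows "(\<Sum>i\<in>I. B (a i) (b i)) = (\<Sum>j\<in>J. B (a' j) (b' j))"
proof -
  define A where "A x = (case x of Inl i \<Rightarrow> a i | Inr j \<Rightarrow> - a' j)" for x
  define C where "C x = (case x of Inl i \<Rightarrow> b i | Inr j \<Rightarrow> b' j)" for x
  have fin: "finite (I <+> J)"
    using assms by simp
  have mem: "\<forall>x\<in>I <+> J. A x \<in> M \<and> C x \<in> N"
    using assms by (auto simp: A_def C_def intro!: csubspace_uminus[OF csubspace_left])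
  have "(\<Sum>x\<in>I <+> J. tens (A x) (C x))
      = (\<Sum>i\<in>I. tens (a i) (b i)) - (\<Sum>j\<in>J. tens (a' j) (b' j))"
    using assms by (simp add: sum.Plus A_def C_def o_def tens_uminus_left sum_negf)
  then have "(\<Sum>x\<in>I <+> J. B (A x) (C x)) = 0"
    using sum_eq_0_if_sum_tens_eq_0[OF fin mem] assms(5) by simp
  moreover have "(\<Sum>x\<in>I <+> J. B (A x) (C x))
      = (\<Sum>i\<in>I. B (a i) (b i)) - (\<Sum>j\<in>J. B (a' j) (b' j))"
    using assms by (simp add: sum.Plus A_def C_def o_def uminus_left sum_negf)
  ultimately show ?thesis
    by simp
qed

end

lemma bilinear_on_tens:
  "csubspace M \<Longrightarrow> csubspace N \<Longrightarrow> linear_on M f \<Longrightarrow> linear_on N g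
   \<Longrightarrow> bilinear_on M N (\<lambda>x y. tens (f x) (g y))"
  by unfold_locales
    (auto simp: linear_on_def tens_add_left tens_add_right tens_csmul_left tens_csmul_right)

lemma bilinear_on_tens_swap:
  "csubspace M \<Longrightarrow> linear_on M f \<Longrightarrow> bilinear_on M M (\<lambda>x y. tens (f y) (f x))"
  by unfold_locales
    (auto simp: linear_on_def tens_add_left tens_add_right tens_csmul_left tens_csmul_right)

lemma bilinear_on_matrix_mult:
  "csubspace M \<Longrightarrow> csubspace N \<Longrightarrow> linear_on M f \<Longrightarrow> linear_on N g
   \<Longrightarrow> bilinear_on M N (\<lambda>x y. f x ** g y)"
  by unfold_locales
    (auto simp: linear_on_def matrix_add_ldistrib matrix_add_rdistrib
      matrix_csmul_left matrix_csmul_right)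

lemma bilinear_on_csmul:
  "csubspace M \<Longrightarrow> csubspace N \<Longrightarrow> linear_form_on M f \<Longrightarrow> linear_on N g
   \<Longrightarrow> bilinear_on M N (\<lambda>x y. csmul (f x) (g y))"
  by unfold_locales
    (auto simp: linear_on_def linear_form_on_def csmul_add csmul_add_left csmul_csmul mult.commute)

lemma tspE:
  assumes "X \<in> tsp M"
  obtains m :: nat and a b where "\<forall>k<m. a k \<in> M \<and> b k \<in> M" "X = (\<Sum>k<m. tens (a k) (b k))"
  using assms unfolding tsp_def by blast

lemma slice_mem_if_mem_tsp:
  assumes M: "csubspace M" and "X \<in> tsp M"
  shows "slice s t X \<in> M"
proof -
  obtain m :: nat and a b where ab: "\<forall>k<m. a k \<in> M \<and> b k \<in> M" and X: "X = (\<Sum>k<m. tens (a k) (b k))"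
    using assms(2) by (rule tspE)
  show ?thesis
    unfolding X slice_sum slice_tens using ab by (auto intro!: csubspace_sum[OF M]
        csubspace_csmul[OF M])
qed

lemma tmap_sum_tens:
  fixes c :: "'x \<Rightarrow> 'y \<Rightarrow> 'z::ab_group_add"
  assumes bil: "bilinear_on M M (\<lambda>x y. c (f x) (g y))"
    and fin: "finite I" and mem: "\<forall>i\<in>I. a i \<in> M \<and> b i \<in> M"
  shows "tmap M c f g (\<Sum>i\<in>I. tens (a i) (b i)) = (\<Sum>i\<in>I. c (f (a i)) (g (b i)))"
  unfolding tmap_def
proof (rule the_equality)
  obtain h where h: "bij_betw h {..<card I} I"
    using ex_bij_betw_nat_finite[OF fin] by (auto simp: atLeast0LessThan)
  have "\<forall>k<card I. a (h k) \<in> M \<and> b (h k) \<in> M"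
    using h mem by (auto simp: bij_betw_def)
  then show "\<exists>(m::nat) a' b'. (\<forall>k<m. a' k \<in> M \<and> b' k \<in> M)
      \<and> (\<Sum>i\<in>I. tens (a i) (b i)) = (\<Sum>k<m. tens (a' k) (b' k))
      \<and> (\<Sum>i\<in>I. c (f (a i)) (g (b i))) = (\<Sum>k<m. c (f (a' k)) (g (b' k)))"
    using sum.reindex_bij_betw[OF h, of "\<lambda>i. tens (a i) (b i)"]
      sum.reindex_bij_betw[OF h, of "\<lambda>i. c (f (a i)) (g (b i))"]
    by (intro exI[of _ "card I"] exI[of _ "a \<circ> h"] exI[of _ "b \<circ> h"]) simp
next
  fix Y
  assume "\<exists>(m::nat) a' b'. (\<forall>k<m. a' k \<in> M \<and> b' k \<in> M)
      \<and> (\<Sum>i\<in>I. tens (a i) (b i)) = (\<Sum>k<m. tens (a' k) (b' k))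
      \<and> Y = (\<Sum>k<m. c (f (a' k)) (g (b' k)))"
  then obtain m :: nat and a' b' where "\<forall>k<m. a' k \<in> M \<and> b' k \<in> M"
    and "(\<Sum>i\<in>I. tens (a i) (b i)) = (\<Sum>k<m. tens (a' k) (b' k))"
    and "Y = (\<Sum>k<m. c (f (a' k)) (g (b' k)))"
    by blast
  then show "Y = (\<Sum>i\<in>I. c (f (a i)) (g (b i)))"
    using bilinear_on.sum_eq_if_sum_tens_eq[OF bil fin mem, of "{..<m}" a' b'] by simp
qed

context
  fixes M assumes M: "csubspace M"
begin

lemma tmap_tens_sum_tens:
  "linear_on M f \<Longrightarrow> linear_on M g \<Longrightarrow> finite I \<Longrightarrow> \<forall>i\<in>I. a i \<in> M \<and> b i \<in> M
   \<Longrightarrow> tmap M tens f g (\<Sum>i\<in>I. tens (a i) (b i)) = (\<Sum>i\<in>I. tens (f (a i)) (g (b i)))"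
  by (rule tmap_sum_tens[where c = tens, OF bilinear_on_tens[OF M M]])

lemma tmap_mult_sum_tens:
  "linear_on M f \<Longrightarrow> linear_on M g \<Longrightarrow> finite I \<Longrightarrow> \<forall>i\<in>I. a i \<in> M \<and> b i \<in> M
   \<Longrightarrow> tmap M (**) f g (\<Sum>i\<in>I. tens (a i) (b i)) = (\<Sum>i\<in>I. f (a i) ** g (b i))"
  by (rule tmap_sum_tens[where c = "(**)", OF bilinear_on_matrix_mult[OF M M]])

lemma tmap_csmul_sum_tens:
  "linear_form_on M f \<Longrightarrow> finite I \<Longrightarrow> \<forall>i\<in>I. a i \<in> M \<and> b i \<in> M
   \<Longrightarrow> tmap M csmul f id (\<Sum>i\<in>I. tens (a i) (b i)) = (\<Sum>i\<in>I. csmul (f (a i)) (b i))"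
  using tmap_sum_tens[where c = csmul and g = id, OF bilinear_on_csmul[OF M M _ linear_on_id]]
      by simp

end

lemma linear_on_tmap:
  fixes c :: "'x \<Rightarrow> 'y \<Rightarrow> complex^('p::finite)^('q::finite)"
  assumes bil: "bilinear_on M M (\<lambda>x y. c (f x) (g y))"
    and hom: "\<And>\<mu> x y. x \<in> M \<Longrightarrow> y \<in> M \<Longrightarrow> c (f (csmul \<mu> x)) (g y) = csmul \<mu> (c (f x) (g y))"
  shows "linear_on (tsp M) (tmap M c f g)"
proof -
  note tmap_sum = tmap_sum_tens[where c = c and f = f and g = g, OF bil]
  show ?thesis
    unfolding linear_on_def
proof (intro conjI ballI allI)
  fix X Y
  assume X: "X \<in> tsp M" and Y: "Y \<in> tsp M"
  obtain m :: nat and a b where ab: "\<forall>k<m. a k \<in> M \<and> b k \<in> M" "X = (\<Sum>k<m. tens (a k) (b k))"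
    using X by (rule tspE)
  obtain m' :: nat and a' b'
    where ab': "\<forall>k<m'. a' k \<in> M \<and> b' k \<in> M" "Y = (\<Sum>k<m'. tens (a' k) (b' k))"
    using Y by (rule tspE)
  define A where "A x = (case x of Inl i \<Rightarrow> a i | Inr j \<Rightarrow> a' j)" for x
  define B where "B x = (case x of Inl i \<Rightarrow> b i | Inr j \<Rightarrow> b' j)" for x
  have mem: "\<forall>x\<in>{..<m} <+> {..<m'}. A x \<in> M \<and> B x \<in> M"
    using ab ab' by (auto simp: A_def B_def)
  have "tmap M c f g (X + Y) = tmap M c f g (\<Sum>x\<in>{..<m} <+> {..<m'}. tens (A x) (B x))"
    using ab ab' by (simp add: sum.Plus A_def B_def o_def)
  also have "\<dots> = (\<Sum>x\<in>{..<m} <+> {..<m'}. c (f (A x)) (g (B x)))"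
    using mem by (intro tmap_sum) auto
  also have "\<dots> = (\<Sum>k<m. c (f (a k)) (g (b k))) + (\<Sum>k<m'. c (f (a' k)) (g (b' k)))"
    by (simp add: sum.Plus A_def B_def o_def)
  also have "\<dots> = tmap M c f g X + tmap M c f g Y"
    using ab ab' by (simp add: tmap_sum)
  finally show "tmap M c f g (X + Y) = tmap M c f g X + tmap M c f g Y" .
next
  fix \<mu> X
  assume "X \<in> tsp M"
  then obtain m :: nat and a b where ab: "\<forall>k<m. a k \<in> M \<and> b k \<in> M" "X = (\<Sum>k<m. tens (a k) (b k))"
    by (rule tspE)
  have "csmul \<mu> X = (\<Sum>k<m. tens (csmul \<mu> (a k)) (b k))"
    using ab by (simp add: csmul_sum tens_csmul_left)
  then show "tmap M c f g (csmul \<mu> X) = csmul \<mu> (tmap M c f g X)"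
    using ab tmap_sum[of "{..<m}" "\<lambda>k. csmul \<mu> (a k)" b] tmap_sum[of "{..<m}" a b] hom
    by (simp add: csmul_sum csubspace_csmul[OF bilinear_on.csubspace_left[OF bil]])
qed
qed

text \<open>\<open>tmap M csmul \<psi> id X\<close> is the slice \<open>(\<psi> \<otimes> id) X\<close> by a linear form \<open>\<psi>\<close> on \<open>M\<close>;
  it is controlled by the slices of \<open>X\<close> by matrix-unit functionals.\<close>

lemma eq_on_tmap_csmul_if_eq_on_slices:
  fixes F G :: "('a::finite) cmat \<Rightarrow> ('b::finite) cmat"
  assumes M: "csubspace M" and X: "X \<in> tsp M"
    and F: "linear_on M F" and G: "linear_on M G" and \<psi>: "linear_form_on M \<psi>"
    and slices: "\<And>s t. F (slice s t X) = G (slice s t X)"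
  shows "F (tmap M csmul \<psi> id X) = G (tmap M csmul \<psi> id X)"
proof -
  obtain m :: nat and a b where ab: "\<forall>k<m. a k \<in> M \<and> b k \<in> M" and X: "X = (\<Sum>k<m. tens (a k) (b k))"
    using X by (rule tspE)
  have "H (slice s t X) = (\<Sum>k<m. csmul (a k $ s $ t) (H (b k)))"
    if "linear_on M H" for H :: "'a cmat \<Rightarrow> 'b cmat" and s t
    unfolding X slice_sum slice_tens using linear_on_lincomb[OF that M, of "{..<m}" b] ab by simp
  then have "(\<Sum>k<m. tens (a k) (F (b k))) = (\<Sum>k<m. tens (a k) (G (b k)))"
    using slices F G by (intro cmat_eq_if_slices_eq) (simp add: slice_sum)
  then have "(\<Sum>k<m. csmul (\<psi> (a k)) (F (b k))) = (\<Sum>k<m. csmul (\<psi> (a k)) (G (b k)))"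
    using ab bilinear_on_csmul[OF M csubspace_UNIV \<psi> linear_on_id]
    by (intro bilinear_on.sum_eq_if_sum_tens_eq[where B = "\<lambda>x Y. csmul (\<psi> x) Y"]) auto
  moreover have "tmap M csmul \<psi> id X = (\<Sum>k<m. csmul (\<psi> (a k)) (b k))"
    unfolding X using ab by (simp add: tmap_csmul_sum_tens[OF M \<psi>])
  ultimately show ?thesis
    using ab linear_on_lincomb[OF F M, of "{..<m}" b] linear_on_lincomb[OF G M, of "{..<m}" b]
    by simp
qed

section \<open>Weak Kac algebras\<close>

locale weak_kac_algebra =
  fixes M :: "('n::finite) cmat set"
    and \<Delta> :: "'n cmat \<Rightarrow> ('n\<times>'n) cmat"
    and S :: "'n cmat \<Rightarrow> 'n cmat"
    and \<epsilon> :: "'n cmat \<Rightarrow> complex"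
  assumes weak_kac: "weak_kac M \<Delta> S \<epsilon>"
begin

abbreviation "e \<equiv> \<Delta> (mat 1)"
abbreviation "\<epsilon>\<^sub>s \<equiv> eps_s M \<Delta> S"
abbreviation "\<epsilon>\<^sub>t \<equiv> eps_t M \<Delta> S"

lemma csubspace: "csubspace M"
  using weak_kac by (simp add: weak_kac_def cstar_subalg_def csubspace_def)

lemma unit_mem: "mat 1 \<in> M"
  using weak_kac by (simp add: weak_kac_def cstar_subalg_def)

lemma mult_mem: "x \<in> M \<Longrightarrow> y \<in> M \<Longrightarrow> x ** y \<in> M"
  using weak_kac by (simp add: weak_kac_def cstar_subalg_def)

lemma Delta_mem_tsp: "x \<in> M \<Longrightarrow> \<Delta> x \<in> tsp M"
  using weak_kac by (simp add: weak_kac_def)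

lemma linear_on_Delta: "linear_on M \<Delta>"
  using weak_kac by (simp add: weak_kac_def linear_on_def)

lemma Delta_adjm: "x \<in> M \<Longrightarrow> \<Delta> (adjm x) = adjm (\<Delta> x)"
  using weak_kac by (simp add: weak_kac_def)

lemma coassoc: "x \<in> M \<Longrightarrow> reassoc (tmap M tens \<Delta> id (\<Delta> x)) = tmap M tens id \<Delta> (\<Delta> x)"
  using weak_kac by (simp add: weak_kac_def)

lemma S_mem: "x \<in> M \<Longrightarrow> S x \<in> M"
  using weak_kac by (auto simp: weak_kac_def bij_betw_def)

lemma linear_on_S: "linear_on M S"
  using weak_kac by (simp add: weak_kac_def linear_on_def)

lemma S_mult: "x \<in> M \<Longrightarrow> y \<in> M \<Longrightarrow> S (x ** y) = S y ** S x"
  using weak_kac by (simp add: weak_kac_def)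

lemma S_unit: "S (mat 1) = mat 1"
  using weak_kac by (simp add: weak_kac_def)

lemma S_S: "x \<in> M \<Longrightarrow> S (S x) = x"
  using weak_kac by (simp add: weak_kac_def)

lemma tmap_S_S_Delta: "x \<in> M \<Longrightarrow> tmap M tens S S (\<Delta> x) = flip (\<Delta> (S x))"
  using weak_kac by (simp add: weak_kac_def)

lemma linear_form_on_counit: "linear_form_on M \<epsilon>"
  using weak_kac by (simp add: weak_kac_def linear_form_on_def)

lemma tmap_counit_Delta: "x \<in> M \<Longrightarrow> tmap M csmul \<epsilon> id (\<Delta> x) = x"
  using weak_kac by (simp add: weak_kac_def)

lemma tmap_eps_s_Delta: "x \<in> M \<Longrightarrow> tmap M tens \<epsilon>\<^sub>s id (\<Delta> x) = tens (mat 1) x ** e"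
  using weak_kac by (simp add: weak_kac_def)

lemma linear_form_on_counit_mult: "y \<in> M \<Longrightarrow> linear_form_on M (\<lambda>x. \<epsilon> (x ** y))"
  using linear_form_on_counit mult_mem
  by (simp add: linear_form_on_def matrix_add_rdistrib matrix_csmul_left csubspace_csmul[OF
      csubspace])

lemma linear_on_eps_s: "linear_on M \<epsilon>\<^sub>s"
proof -
  have "linear_on (tsp M) (tmap M (**) S id)"
    by (rule linear_on_tmap[where c = "(**)",
          OF bilinear_on_matrix_mult[OF csubspace csubspace linear_on_S linear_on_id]])
      (simp add: matrix_csmul_left linear_onD(2)[OF linear_on_S])
  then show ?thesis
    unfolding eps_s_def[abs_def] using linear_on_comp linear_on_Delta Delta_mem_tsp by blast
qed

lemma linear_on_eps_t: "linear_on M \<epsilon>\<^sub>t"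
proof -
  have "linear_on (tsp M) (tmap M (**) id S)"
    by (rule linear_on_tmap[where c = "(**)",
          OF bilinear_on_matrix_mult[OF csubspace csubspace linear_on_id linear_on_S]])
      (simp add: matrix_csmul_left)
  then show ?thesis
    unfolding eps_t_def[abs_def] using linear_on_comp linear_on_Delta Delta_mem_tsp by blast
qed

context
  fixes x m and a b :: "nat \<Rightarrow> 'n cmat"
  assumes mem: "\<forall>k<m. a k \<in> M \<and> b k \<in> M" and Delta_eq: "\<Delta> x = (\<Sum>k<m. tens (a k) (b k))"
begin

lemma eps_s_eq_sum: "\<epsilon>\<^sub>s x = (\<Sum>k<m. S (a k) ** b k)"
  unfolding eps_s_def Delta_eq using mem
  by (simp add: tmap_mult_sum_tens[OF csubspace linear_on_S linear_on_id])

lemma eps_t_eq_sum: "\<epsilon>\<^sub>t x = (\<Sum>k<m. a k ** S (b k))"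
  unfolding eps_t_def Delta_eq using mem
  by (simp add: tmap_mult_sum_tens[OF csubspace linear_on_id linear_on_S])

lemma Delta_S_eq_sum:
  assumes "x \<in> M"
  shows "\<Delta> (S x) = (\<Sum>k<m. tens (S (b k)) (S (a k)))"
proof -
  have "flip (\<Delta> (S x)) = (\<Sum>k<m. tens (S (a k)) (S (b k)))"
    using mem by (simp add: tmap_S_S_Delta[OF assms, symmetric] Delta_eq
        tmap_tens_sum_tens[OF csubspace linear_on_S linear_on_S])
  then have "flip (flip (\<Delta> (S x))) = (\<Sum>k<m. tens (S (b k)) (S (a k)))"
    by (simp add: flip_sum flip_tens)
  then show ?thesis
    by (simp add: flip_flip)
qed

end

lemma eps_s_mem:
  assumes "x \<in> M"
  shows "\<epsilon>\<^sub>s x \<in> M"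
proof -
  obtain m :: nat and a b where "\<forall>k<m. a k \<in> M \<and> b k \<in> M" "\<Delta> x = (\<Sum>k<m. tens (a k) (b k))"
    using Delta_mem_tsp[OF assms] by (rule tspE)
  then show ?thesis
    by (auto simp: eps_s_eq_sum intro!: csubspace_sum[OF csubspace] mult_mem S_mem)
qed

lemma eps_t_mem:
  assumes "x \<in> M"
  shows "\<epsilon>\<^sub>t x \<in> M"
proof -
  obtain m :: nat and a b where "\<forall>k<m. a k \<in> M \<and> b k \<in> M" "\<Delta> x = (\<Sum>k<m. tens (a k) (b k))"
    using Delta_mem_tsp[OF assms] by (rule tspE)
  then show ?thesis
    by (auto simp: eps_t_eq_sum intro!: csubspace_sum[OF csubspace] mult_mem S_mem)
qed

lemma S_eps_s_S:
  assumes x: "x \<in> M"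
  shows "S (\<epsilon>\<^sub>s (S x)) = \<epsilon>\<^sub>t x"
proof -
  obtain m :: nat and a b where ab: "\<forall>k<m. a k \<in> M \<and> b k \<in> M"
    and Dx: "\<Delta> x = (\<Sum>k<m. tens (a k) (b k))"
    using Delta_mem_tsp[OF x] by (rule tspE)
  have Sab: "\<forall>k<m. S (b k) \<in> M \<and> S (a k) \<in> M"
    using ab S_mem by auto
  have "S (\<epsilon>\<^sub>s (S x)) = S (\<Sum>k<m. S (S (b k)) ** S (a k))"
    using eps_s_eq_sum[OF Sab Delta_S_eq_sum[OF ab Dx x]] by simp
  also have "\<dots> = (\<Sum>k<m. S (S (S (b k)) ** S (a k)))"
    using Sab by (intro linear_on_sum[OF linear_on_S csubspace]) (auto intro: mult_mem S_mem)
  also have "\<dots> = (\<Sum>k<m. a k ** S (b k))"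
    using ab by (simp add: S_mult S_mem S_S)
  also have "\<dots> = \<epsilon>\<^sub>t x"
    using eps_t_eq_sum[OF ab Dx] by simp
  finally show ?thesis .
qed

lemma tmap_eps_t_Delta:
  assumes x: "x \<in> M"
  shows "tmap M tens id \<epsilon>\<^sub>t (\<Delta> x) = e ** tens x (mat 1)"
proof -
  obtain m :: nat and a b where ab: "\<forall>k<m. a k \<in> M \<and> b k \<in> M"
    and Dx: "\<Delta> x = (\<Sum>k<m. tens (a k) (b k))"
    using Delta_mem_tsp[OF x] by (rule tspE)
  obtain n :: nat and p q where pq: "\<forall>k<n. p k \<in> M \<and> q k \<in> M" and e: "e = (\<Sum>k<n. tens (p k) (q k))"
    using Delta_mem_tsp[OF unit_mem] by (rule tspE)
  have Sx: "S x \<in> M" and Sab: "\<forall>k<m. S (b k) \<in> M \<and> S (a k) \<in> M"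
    using x ab S_mem by auto
  have "(\<Sum>k<m. tens (\<epsilon>\<^sub>s (S (b k))) (S (a k))) = tmap M tens \<epsilon>\<^sub>s id (\<Delta> (S x))"
    using Sab by (simp add: Delta_S_eq_sum[OF ab Dx x] tmap_tens_sum_tens[OF csubspace
        linear_on_eps_s linear_on_id])
  also have "\<dots> = (\<Sum>k<n. tens (p k) (S x ** q k))"
    by (simp add: tmap_eps_s_Delta[OF Sx] e matrix_sum_right tens_mult)
  finally have "(\<Sum>k<m. tens (S (S (a k))) (S (\<epsilon>\<^sub>s (S (b k))))) = (\<Sum>k<n. tens (S (S x ** q k)) (S
      (p k)))"
    using Sab pq Sx
    by (intro bilinear_on.sum_eq_if_sum_tens_eq[OF bilinear_on_tens_swap[OF csubspace linear_on_S]])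
      (auto intro: eps_s_mem mult_mem)
  then have "(\<Sum>k<m. tens (a k) (\<epsilon>\<^sub>t (b k))) = (\<Sum>k<n. tens (S (q k)) (S (p k))) ** tens x (mat 1)"
    using ab pq x by (simp add: S_S S_eps_s_S S_mult S_mem matrix_sum_left tens_mult)
  also have "(\<Sum>k<n. tens (S (q k)) (S (p k))) = e"
    using Delta_S_eq_sum[OF pq e unit_mem] by (simp add: S_unit)
  finally show ?thesis
    using ab by (simp add: Dx tmap_tens_sum_tens[OF csubspace linear_on_id linear_on_eps_t])
qed

lemma eps_t_eq_tmap_counit_mult:
  assumes y: "y \<in> M"
  shows "\<epsilon>\<^sub>t y = tmap M csmul (\<lambda>x. \<epsilon> (x ** y)) id e"
proof -
  obtain m :: nat and a b where ab: "\<forall>k<m. a k \<in> M \<and> b k \<in> M"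
    and Dy: "\<Delta> y = (\<Sum>k<m. tens (a k) (b k))"
    using Delta_mem_tsp[OF y] by (rule tspE)
  obtain n :: nat and p q where pq: "\<forall>k<n. p k \<in> M \<and> q k \<in> M" and e: "e = (\<Sum>k<n. tens (p k) (q k))"
    using Delta_mem_tsp[OF unit_mem] by (rule tspE)
  have "(\<Sum>k<m. tens (a k) (\<epsilon>\<^sub>t (b k))) = (\<Sum>k<n. tens (p k ** y) (q k))"
    using tmap_eps_t_Delta[OF y] ab
    by (simp add: Dy e tmap_tens_sum_tens[OF csubspace linear_on_id linear_on_eps_t]
        matrix_sum_left tens_mult)
  then have "(\<Sum>k<m. csmul (\<epsilon> (a k)) (\<epsilon>\<^sub>t (b k))) = (\<Sum>k<n. csmul (\<epsilon> (p k ** y)) (q k))"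
    using ab pq y
    by (intro bilinear_on.sum_eq_if_sum_tens_eq[OF bilinear_on_csmul[OF csubspace csubspace
          linear_form_on_counit linear_on_id], simplified])
      (auto intro: eps_t_mem mult_mem)
  moreover have "(\<Sum>k<m. csmul (\<epsilon> (a k)) (\<epsilon>\<^sub>t (b k))) = \<epsilon>\<^sub>t y"
    using ab tmap_counit_Delta[OF y]
      linear_on_lincomb[OF linear_on_eps_t csubspace, of "{..<m}" b "\<lambda>k. \<epsilon> (a k)"]
    by (simp add: Dy tmap_csmul_sum_tens[OF csubspace linear_form_on_counit])
  ultimately show ?thesis
    using pq by (simp add: e tmap_csmul_sum_tens[OF csubspace linear_form_on_counit_mult[OF y]])
qed

lemma eps_t_unit: "\<epsilon>\<^sub>t (mat 1) = mat 1"
  using eps_t_eq_tmap_counit_mult[OF unit_mem] tmap_counit_Delta[OF unit_mem] by simp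

lemma slice_unit_mem: "slice s t e \<in> M"
  by (rule slice_mem_if_mem_tsp[OF csubspace Delta_mem_tsp[OF unit_mem]])

lemma Delta_slice_unit_left: "\<Delta> (slice s t e) = e ** tens (slice s t e) (mat 1)"
proof -
  obtain n :: nat and p q where pq: "\<forall>k<n. p k \<in> M \<and> q k \<in> M" and e: "e = (\<Sum>k<n. tens (p k) (q k))"
    using Delta_mem_tsp[OF unit_mem] by (rule tspE)
  define L where "L x = slice s t (\<Delta> x)" for x
  have L_mem: "L x \<in> M" if "x \<in> M" for x
    unfolding L_def by (rule slice_mem_if_mem_tsp[OF csubspace Delta_mem_tsp[OF that]])
  have linear_L: "linear_on M L"
    using linear_on_Delta by (simp add: linear_on_def L_def slice_add slice_csmul)
  have "\<Delta> (slice s t e) = (\<Sum>k<n. csmul (p k $ s $ t) (\<Delta> (q k)))"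
    using pq linear_on_lincomb[OF linear_on_Delta csubspace, of "{..<n}" q "\<lambda>k. p k $ s $ t"]
    by (simp add: e slice_sum)
  also have "\<dots> = slice s t (tmap M tens id \<Delta> e)"
    using pq by (simp add: e tmap_tens_sum_tens[OF csubspace linear_on_id linear_on_Delta]
        slice_sum)
  also have "\<dots> = slice s t (reassoc (tmap M tens \<Delta> id e))"
    by (simp add: coassoc[OF unit_mem])
  also have "\<dots> = (\<Sum>k<n. tens (L (p k)) (q k))"
    using pq by (simp add: e tmap_tens_sum_tens[OF csubspace linear_on_Delta linear_on_id]
        reassoc_sum slice_sum slice_reassoc_tens L_def)
  finally have Delta_z: "\<Delta> (slice s t e) = (\<Sum>k<n. tens (L (p k)) (q k))" .
  have "(\<Sum>k<n. tens (p k) (\<epsilon>\<^sub>t (q k))) = (\<Sum>k<n. tens (p k) (q k))"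
    using tmap_eps_t_Delta[OF unit_mem] pq
    by (simp add: e tmap_tens_sum_tens[OF csubspace linear_on_id linear_on_eps_t] tens_one)
  then have "(\<Sum>k<n. tens (L (p k)) (\<epsilon>\<^sub>t (q k))) = (\<Sum>k<n. tens (L (p k)) (q k))"
    using pq
    by (intro bilinear_on.sum_eq_if_sum_tens_eq[OF bilinear_on_tens[OF csubspace csubspace
          linear_L linear_on_id], simplified])
      (auto intro: eps_t_mem)
  then have "tmap M tens id \<epsilon>\<^sub>t (\<Delta> (slice s t e)) = \<Delta> (slice s t e)"
    using pq L_mem by (simp add: Delta_z tmap_tens_sum_tens[OF csubspace linear_on_id
        linear_on_eps_t])
  then show ?thesis
    using tmap_eps_t_Delta[OF slice_unit_mem] by simp
qed

lemma Delta_slice_unit_right: "\<Delta> (slice s t e) = tens (slice s t e) (mat 1) ** e"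
proof -
  have adjm_e: "adjm e = e"
    using Delta_adjm[OF unit_mem] by (simp add: adjm_one)
  then have "slice s t e = adjm (slice t s e)"
    by (metis slice_adjm)
  then have "\<Delta> (slice s t e) = adjm (e ** tens (slice t s e) (mat 1))"
    by (simp add: Delta_adjm[OF slice_unit_mem] Delta_slice_unit_left)
  also have "\<dots> = tens (slice s t e) (mat 1) ** e"
    by (simp add: adjm_mult adjm_tens adjm_one adjm_e \<open>slice s t e = adjm (slice t s e)\<close>)
  finally show ?thesis .
qed

lemma eps_t_mem_Nt:
  assumes y: "y \<in> M"
  shows "\<epsilon>\<^sub>t y \<in> Nt M \<Delta>"
proof -
  note slice_map_eq = eq_on_tmap_csmul_if_eq_on_slices[OF csubspace Delta_mem_tsp[OF unit_mem]
      linear_on_Delta _ linear_form_on_counit_mult[OF y]]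
  have "linear_on M (\<lambda>z. e ** tens z (mat 1))" "linear_on M (\<lambda>z. tens z (mat 1) ** e)"
    by (simp_all add: linear_on_def tens_add_left tens_csmul_left matrix_add_ldistrib
        matrix_add_rdistrib matrix_csmul_left matrix_csmul_right)
  then have "\<Delta> (\<epsilon>\<^sub>t y) = e ** tens (\<epsilon>\<^sub>t y) (mat 1)" and "\<Delta> (\<epsilon>\<^sub>t y) = tens (\<epsilon>\<^sub>t y) (mat 1) ** e"
    unfolding eps_t_eq_tmap_counit_mult[OF y]
    using Delta_slice_unit_left Delta_slice_unit_right by (auto intro!: slice_map_eq)
  then show ?thesis
    by (simp add: Nt_def eps_t_mem[OF y])
qed

end

theorem corollary2p1p9:
  fixes M :: "('n::finite) cmat set"
    and \<Delta> :: "'n cmat \<Rightarrow> ('n\<times>'n) cmat"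
    and S :: "'n cmat \<Rightarrow> 'n cmat"
    and \<epsilon> :: "'n cmat \<Rightarrow> complex"
  assumes "weak_kac M \<Delta> S \<epsilon>"
  shows "eps_t M \<Delta> S (mat 1) = mat 1
    \<and> (\<forall>x\<in>M. eps_t M \<Delta> S x \<in> Nt M \<Delta>)
    \<and> (\<forall>x\<in>Ns M \<Delta>. tmap M tens id (eps_t M \<Delta> S) (\<Delta> x) = \<Delta> (mat 1) ** tens x (mat 1))"
proof -
  interpret weak_kac_algebra M \<Delta> S \<epsilon>
    by (rule weak_kac_algebra.intro[OF assms])
  show ?thesis
    using eps_t_unit eps_t_mem_Nt tmap_eps_t_Delta unfolding Ns_def by blast
qed

end
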